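(* Let $\Bbbk$ be a field of characteristic $0$, let $(A,\circ,\ast,\omega,R)$ be a finite-dimensional quadratic Rota-Baxter DPP algebra of weight $0$ over $\Bbbk$, and let $J_\omega:A^*\to A$ be the linear isomorphism induced by $\omega$, i.e. $\langle J_\omega^{-1}(a_1),a_2\rangle=\omega(a_1,a_2)$ for all $a_1,a_2\in A$. Then $(A,\circ,\ast,\nu_{r_\omega},\vartheta_{r_\omega})$ is a triangular DPP bialgebra, where $r_\omega\in A\otimes A$ is given by $\langle r_\omega,\xi_1\otimes\xi_2\rangle=\langle R(J_\omega(\xi_1)),\xi_2\rangle$ for all $\xi_1,\xi_2\in A^*$.
   Context: All vector spaces are finite-dimensional over a field $\Bbbk$ of characteristic $0$; $\langle-,-\rangle$ is the natural pairing; $\tau(x\otimes y)=y\otimes x$. **DPP algebras.** A perm algebra $(A,\circ)$ satisfies $a_1\circ(a_2\circ a_3)=(a_1\circ a_2)\circ a_3=(a_2\circ a_1)\circ a_3$. A (left) Leibniz algebra $(A,\ast)$ satisfies $a_1\ast(a_2\ast a_3)=(a_1\ast a_2)\ast a_3+a_2\ast(a_1\ast a_3)$. A dual pre-Poisson (DPP) algebra $(A,\circ,\ast)$ is a perm algebra and a Leibniz algebra with $(a_1\circ a_2)\ast a_3=a_1\circ(a_2\ast a_3)+a_2\circ(a_1\ast a_3)$ and $(a_1\ast a_2)\circ a_3=a_1\ast(a_2\circ a_3)-a_2\circ(a_1\ast a_3)=-(a_2\ast a_1)\circ a_3$. Write $L(a)b=a\circ b$, $R_\circ(a)b=b\circ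 a$, $\tilde L(a)b=a\ast b$, $\tilde R(a)b=b\ast a$. **Quadratic Rota-Baxter DPP algebras of weight 0.** $(A,\circ,\ast,\omega,R)$: a DPP algebra with a nondegenerate skew-symmetric bilinear form $\omega$ with $\omega(a_1\circ a_2,a_3)=\omega(a_1,a_2\circ a_3-a_3\circ a_2)$ and $\omega(a_1\ast a_2,a_3)=\omega(a_1,a_2\ast a_3+a_3\ast a_2)$, and a linear map $R:A\to A$ with $R(a_1)\circ R(a_2)=R(R(a_1)\circ a_2+a_1\circ R(a_2))$, $R(a_1)\ast R(a_2)=R(R(a_1)\ast a_2+a_1\ast R(a_2))$, and $\omega(a_1,R(a_2))+\omega(R(a_1),a_2)=0$. **DPP coalgebras.** $(A,\nu,\vartheta)$ with $\nu,\vartheta:A\to A\otimes A$ is a DPP coalgebra if $(\nu\otimes\mathrm{id})\nu=(\mathrm{id}\otimes\nu)\nu=(\tau\otimes\mathrm{id})(\mathrm{id}\otimes\nu)\nu$, $(\mathrm{id}\otimes\vartheta)\vartheta=(\vartheta\otimes\mathrm{id})\vartheta+(\tau\otimes\mathrm{id})(\mathrm{id}\otimes\vartheta)\vartheta$, $(\mathrm{id}\otimes\nu)\vartheta=(\vartheta\otimes\mathrm{id})\nu+(\tau\otimes\mathrm{id})(\mathrm{id}\otimes\vartheta)\nu$, $(\nu\otimes\mathrm{id})\vartheta=(\mathrm{id}\otimes\vartheta)\nu+(\tau\otimes\mathrm{id})(\mathrm{id}\otimes\vartheta)\nu$, $(\vartheta\otimes\mathrm{id})\nu=-(\tau\otimes\mathrm{id})(\vartheta\otimes\mathrm{id})\nu$.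 **DPP bialgebras.** $(A,\circ,\ast,\nu,\vartheta)$ is a DPP bialgebra if $(A,\circ,\ast)$ is a DPP algebra, $(A,\nu,\vartheta)$ is a DPP coalgebra, and for all $a_1,a_2\in A$, with $\nu^-:=\nu-\tau\nu$, $\vartheta^+:=\vartheta+\tau\vartheta$: (perm bialgebra) $(R_\circ(a_1)\otimes\mathrm{id})\nu(a_2)=\tau((R_\circ(a_2)\otimes\mathrm{id})\nu(a_1))$; $\nu(a_1\circ a_2)=((L-R_\circ)(a_1)\otimes\mathrm{id})\nu(a_2)+(\mathrm{id}\otimes R_\circ(a_2))\nu(a_1)$; $\nu(a_1\circ a_2)=(\mathrm{id}\otimes L(a_1))\nu(a_2)+((L-R_\circ)(a_2)\otimes\mathrm{id})\nu^-(a_1)$; (Leibniz bialgebra) $\tau((\tilde R(a_2)\otimes\mathrm{id})\vartheta(a_1))=(\tilde R(a_1)\otimes\mathrm{id})\vartheta(a_2)$; $\vartheta(a_1\ast a_2)=(\mathrm{id}\otimes\tilde R(a_2)-(\tilde L+\tilde R)(a_2)\otimes\mathrm{id})\vartheta^+(a_1)+(\mathrm{id}\otimes\tilde L(a_1)+\tilde L(a_1)\otimes\mathrm{id})\vartheta(a_2)$; 1. $\nu(a_1\ast a_2)=(\mathrm{id}\otimes\tilde L(a_1)+\tilde L(a_1)\otimes\mathrm{id})\nu(a_2)+((L-R_\circ)(a_2)\otimes\mathrm{id}-\mathrm{id}\otimes R_\circ(a_2))\vartheta^+(a_1)$; 2. $\vartheta(a_1\circ a_2)=(\mathrm{id}\otimes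 L(a_1))\vartheta(a_2)+(\mathrm{id}\otimes R_\circ(a_2))\vartheta(a_1)-((\tilde L+\tilde R)(a_1)\otimes\mathrm{id})\nu(a_2)-((\tilde L+\tilde R)(a_2)\otimes\mathrm{id})\nu^-(a_1)$; 3. $(\mathrm{id}\otimes\tilde R(a_1))\tau\nu(a_2)=-(R_\circ(a_2)\otimes\mathrm{id})\vartheta(a_1)$; 4. $\nu(a_1\ast a_2)=(\mathrm{id}\otimes L(a_1)-L(a_1)\otimes\mathrm{id})\vartheta(a_2)+(\mathrm{id}\otimes\tilde R(a_2)-(\tilde L+\tilde R)(a_2)\otimes\mathrm{id})\nu^-(a_1)$; 5. $\vartheta^+(a_1\circ a_2)=(\mathrm{id}\otimes L(a_1))\vartheta^+(a_2)+(\mathrm{id}\otimes L(a_2))\vartheta^+(a_1)-(\tilde L(a_1)\otimes\mathrm{id})\nu^-(a_2)-(\tilde L(a_2)\otimes\mathrm{id})\nu^-(a_1)$; 6. $\vartheta(a_1\circ a_2)=(L(a_1)\otimes\mathrm{id})\vartheta(a_2)-(\mathrm{id}\otimes\tilde R(a_2))\nu^-(a_1)+(\mathrm{id}\otimes\tilde L(a_1))\nu(a_2)+((L-R_\circ)(a_2)\otimes\mathrm{id})\vartheta^+(a_1)$; 7. $\nu(a_1\ast a_2+a_2\ast a_1)=(\mathrm{id}\otimes(\tilde L+\tilde R)(a_1))\nu(a_2)+((\tilde L+\tilde R)(a_1)\otimes\mathrm{id})\tau\nu(a_2)+(\mathrm{id}\otimes(L-R_\circ)(a_2))\vartheta(a_1)+((L-R_\circ)(a_2)\otimes\mathrm{id})\tau\vartheta(a_1)$.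 **Triangular DPP bialgebras.** For $r\in A\otimes A$: $\nu_r(a)=(\mathrm{id}\otimes R_\circ(a)+(R_\circ-L)(a)\otimes\mathrm{id})(r)$, $\vartheta_r(a)=((\tilde L+\tilde R)(a)\otimes\mathrm{id}-\mathrm{id}\otimes\tilde R(a))(r)$. For $r=\sum_i x_i\otimes y_i$, the DPYBE is the pair $\mathbf P_r=\sum_{i,j}\big(x_i\otimes(y_i\circ x_j)\otimes y_j-x_i\otimes x_j\otimes(y_i\circ y_j)+(x_i\circ x_j)\otimes y_i\otimes y_j-(x_i\circ x_j)\otimes y_j\otimes y_i\big)=0$, $\mathbf L_r=\sum_{i,j}\big((x_i\ast x_j)\otimes y_i\otimes y_j-x_i\otimes(y_i\ast x_j)\otimes y_j-x_j\otimes(x_i\ast y_j)\otimes y_i+x_j\otimes x_i\otimes(y_i\ast y_j)\big)=0$. A triangular DPP bialgebra associated with $r$ is a DPP bialgebra of the form $(A,\circ,\ast,\nu_r,\vartheta_r)$ with $r$ a symmetric ($\tau(r)=r$) solution of the DPYBE. *)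

theory Defs
  imports "HOL.Vector_Spaces" "HOL-Library.Function_Algebras"
begin

section \<open>Tensor powers of a vector space\<close>

text \<open>
  For a vector space \<open>A\<close> over a field \<open>k\<close>, the tensor \<open>x \<otimes> y\<close> is represented by its pairing
  with pairs of functionals, \<open>\<langle>x \<otimes> y, \<xi> \<otimes> \<eta>\<rangle> = \<xi> x * \<eta> y\<close>, and \<open>A \<otimes> A\<close> is the set of finite sums
  of such elements; likewise for \<open>A \<otimes> A \<otimes> A\<close>.  The lemmas \<open>tensor2_universal\<close> and
  \<open>tensor3_universal\<close> state that this is the tensor product: every bilinear (trilinear) map into
  any vector space is well defined on sums of pure tensors.  The functions representing tensors
  are \<open>0\<close> outside the dual space, so that equality of tensors is equality in HOL.  Addition,
  subtraction and \<open>0\<close> are the pointwise ones of the function type.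
\<close>

type_synonym ('k, 'v) tensor2 = "('v \<Rightarrow> 'k) \<Rightarrow> ('v \<Rightarrow> 'k) \<Rightarrow> 'k"
type_synonym ('k, 'v) tensor3 = "('v \<Rightarrow> 'k) \<Rightarrow> ('v \<Rightarrow> 'k) \<Rightarrow> ('v \<Rightarrow> 'k) \<Rightarrow> 'k"

definition bilinear_map ::
    "('k::field \<Rightarrow> 'v::ab_group_add \<Rightarrow> 'v) \<Rightarrow> ('k \<Rightarrow> 'w::ab_group_add \<Rightarrow> 'w) \<Rightarrow> ('v \<Rightarrow> 'v \<Rightarrow> 'w) \<Rightarrow> bool"
  where "bilinear_map s s' f \<longleftrightarrow>
    (\<forall>x. Vector_Spaces.linear s s' (\<lambda>y. f x y)) \<and> (\<forall>y. Vector_Spaces.linear s s' (\<lambda>x. f x y))"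

definition trilinear_map ::
    "('k::field \<Rightarrow> 'v::ab_group_add \<Rightarrow> 'v) \<Rightarrow> ('k \<Rightarrow> 'w::ab_group_add \<Rightarrow> 'w) \<Rightarrow> ('v \<Rightarrow> 'v \<Rightarrow> 'v \<Rightarrow> 'w) \<Rightarrow> bool"
  where "trilinear_map s s' f \<longleftrightarrow>
    (\<forall>x y. Vector_Spaces.linear s s' (\<lambda>z. f x y z)) \<and>
    (\<forall>x z. Vector_Spaces.linear s s' (\<lambda>y. f x y z)) \<and>
    (\<forall>y z. Vector_Spaces.linear s s' (\<lambda>x. f x y z))"

definition tensor2_scale :: "'k::field \<Rightarrow> ('k, 'v) tensor2 \<Rightarrow> ('k, 'v) tensor2"
  where "tensor2_scale c t = (\<lambda>\<xi> \<eta>. c * t \<xi> \<eta>)"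

text \<open>The flip \<open>\<tau>\<close>, and \<open>\<tau> \<otimes> id\<close> on \<open>A \<otimes> A \<otimes> A\<close>.\<close>

definition flip :: "('k, 'v) tensor2 \<Rightarrow> ('k, 'v) tensor2"  (\<open>\<tau>\<close>)
  where "\<tau> t = (\<lambda>\<xi> \<eta>. t \<eta> \<xi>)"

definition flip12 :: "('k, 'v) tensor3 \<Rightarrow> ('k, 'v) tensor3"  (\<open>\<tau>\<^sub>1\<^sub>2\<close>)
  where "\<tau>\<^sub>1\<^sub>2 t = (\<lambda>\<xi> \<eta> \<zeta>. t \<eta> \<xi> \<zeta>)"

context vector_space
begin

definition dual :: "('b \<Rightarrow> 'a) set"
  where "dual = {\<xi>. Vector_Spaces.linear scale (*) \<xi>}"

definition tensor2 :: "'b \<Rightarrow> 'b \<Rightarrow> ('a, 'b) tensor2"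
  where "tensor2 x y = (\<lambda>\<xi> \<eta>. if \<xi> \<in> dual \<and> \<eta> \<in> dual then \<xi> x * \<eta> y else 0)"

definition tensor3 :: "'b \<Rightarrow> 'b \<Rightarrow> 'b \<Rightarrow> ('a, 'b) tensor3"
  where "tensor3 x y z =
    (\<lambda>\<xi> \<eta> \<zeta>. if \<xi> \<in> dual \<and> \<eta> \<in> dual \<and> \<zeta> \<in> dual then \<xi> x * \<eta> y * \<zeta> z else 0)"

definition tensor2_space :: "('a, 'b) tensor2 set"
  where "tensor2_space = {\<Sum>i<n. tensor2 (x i) (y i) | (n::nat) x y. True}"

definition tensor_map :: "('b \<Rightarrow> 'b) \<Rightarrow> ('b \<Rightarrow> 'b) \<Rightarrow> ('a, 'b) tensor2 \<Rightarrow> ('a, 'b) tensor2"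
    (infixr \<open>\<otimes>\<^sub>m\<close> 72)
  where "(f \<otimes>\<^sub>m g) t =
    (\<lambda>\<xi> \<eta>. if \<xi> \<in> dual \<and> \<eta> \<in> dual then t (\<lambda>x. \<xi> (f x)) (\<lambda>y. \<eta> (g y)) else 0)"

text \<open>\<open>\<delta> \<otimes> id\<close> and \<open>id \<otimes> \<delta>\<close> as maps \<open>A \<otimes> A \<rightarrow> A \<otimes> A \<otimes> A\<close>, for a linear map \<open>\<delta> : A \<rightarrow> A \<otimes> A\<close>.\<close>

definition comap_id :: "('b \<Rightarrow> ('a, 'b) tensor2) \<Rightarrow> ('a, 'b) tensor2 \<Rightarrow> ('a, 'b) tensor3"
    (\<open>_ \<otimes>id\<close> [1000] 1000)
  where "\<delta> \<otimes>id t =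
    (\<lambda>\<xi> \<eta> \<zeta>. if \<xi> \<in> dual \<and> \<eta> \<in> dual \<and> \<zeta> \<in> dual then t (\<lambda>x. \<delta> x \<xi> \<eta>) \<zeta> else 0)"

definition id_comap :: "('b \<Rightarrow> ('a, 'b) tensor2) \<Rightarrow> ('a, 'b) tensor2 \<Rightarrow> ('a, 'b) tensor3"
    (\<open>id\<otimes> _\<close> [1000] 1000)
  where "id\<otimes> \<delta> t =
    (\<lambda>\<xi> \<eta> \<zeta>. if \<xi> \<in> dual \<and> \<eta> \<in> dual \<and> \<zeta> \<in> dual then t \<xi> (\<lambda>y. \<delta> y \<eta> \<zeta>) else 0)"

end

lemma vs_linear_iff:
  "Vector_Spaces.linear s1 s2 f \<longleftrightarrow> vector_space s1 \<and> vector_space s2 \<and>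
    (\<forall>x y. f (x + y) = f x + f y) \<and> (\<forall>c x. f (s1 c x) = s2 c (f x))"
  unfolding Vector_Spaces.linear_def module_hom_def module_hom_axioms_def module_iff_vector_space
  by blast

lemma vector_space_tensor2_scale:
  "vector_space (tensor2_scale :: 'k::field \<Rightarrow> ('k, 'v) tensor2 \<Rightarrow> _)"
  by unfold_locales (auto simp: tensor2_scale_def fun_eq_iff algebra_simps)

context vector_space
begin

lemma dual_add: "\<xi> \<in> dual \<Longrightarrow> \<xi> (x + y) = \<xi> x + \<xi> y"
  and dual_scale: "\<xi> \<in> dual \<Longrightarrow> \<xi> (c *s x) = c * \<xi> x"
  by (simp_all add: dual_def vs_linear_iff)

lemma tensor2_bilinear: "bilinear_map scale tensor2_scale tensor2"
  by (auto simp: bilinear_map_def vs_linear_iff vector_space_axioms vector_space_tensor2_scale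
      tensor2_def tensor2_scale_def fun_eq_iff dual_add dual_scale algebra_simps)

lemma flip_tensor2: "\<tau> (tensor2 x y) = tensor2 y x"
  by (auto simp: flip_def tensor2_def fun_eq_iff)

lemma flip12_tensor3: "\<tau>\<^sub>1\<^sub>2 (tensor3 x y z) = tensor3 y x z"
  by (auto simp: flip12_def tensor3_def fun_eq_iff)

lemma sum_fun: "(\<Sum>i\<in>I. f i) x = (\<Sum>i\<in>I. f i x)"
  by (induction I rule: infinite_finite_induct) auto

lemma dual_comp:
  assumes "\<xi> \<in> dual" "Vector_Spaces.linear scale scale f"
  shows "(\<lambda>x. \<xi> (f x)) \<in> dual"
  using assms by (auto simp: dual_def vs_linear_iff)

lemma tensor_map_sum:
  assumes "Vector_Spaces.linear scale scale f" "Vector_Spaces.linear scale scale g"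
  shows "(f \<otimes>\<^sub>m g) (\<Sum>i<n. tensor2 (x i) (y i)) = (\<Sum>i<n. tensor2 (f (x i)) (g (y i)))"
  using assms by (auto simp: tensor_map_def fun_eq_iff sum_fun tensor2_def dual_comp)

lemma dual_comap:
  assumes "Vector_Spaces.linear scale tensor2_scale \<delta>"
  shows "(\<lambda>x. \<delta> x \<xi> \<eta>) \<in> dual"
proof -
  have "vector_space ((*) :: 'a \<Rightarrow> 'a \<Rightarrow> 'a)"
    by unfold_locales (auto simp: algebra_simps)
  then show ?thesis
    using assms by (auto simp: dual_def vs_linear_iff tensor2_scale_def)
qed

lemma comap_id_tensor2:
  assumes "Vector_Spaces.linear scale tensor2_scale \<delta>" "\<delta> x = (\<Sum>i<n. tensor2 (u i) (v i))"
  shows "\<delta> \<otimes>id (tensor2 x y) = (\<Sum>i<n. tensor3 (u i) (v i) y)"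
  using assms
  by (auto simp: comap_id_def fun_eq_iff sum_fun tensor2_def tensor3_def dual_comap
      sum_distrib_right)

lemma id_comap_tensor2:
  assumes "Vector_Spaces.linear scale tensor2_scale \<delta>" "\<delta> y = (\<Sum>i<n. tensor2 (u i) (v i))"
  shows "id\<otimes> \<delta> (tensor2 x y) = (\<Sum>i<n. tensor3 x (u i) (v i))"
  using assms
  by (auto simp: id_comap_def fun_eq_iff sum_fun tensor2_def tensor3_def dual_comap
      sum_distrib_left mult.assoc)

lemma comap_add:
  "\<delta> \<otimes>id (s + t) = \<delta> \<otimes>id s + \<delta> \<otimes>id t"
  "id\<otimes> \<delta> (s + t) = id\<otimes> \<delta> s + id\<otimes> \<delta> t"
  by (auto simp: comap_id_def id_comap_def fun_eq_iff)

end

context finite_dimensional_vector_space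
begin

abbreviation "coord v b \<equiv> representation Basis v b"

lemma coord_dual: "(\<lambda>v. coord v b) \<in> dual"
  using linear_representation[OF independent_Basis span_Basis] by (simp add: dual_def)

lemma coord_expand: "v = (\<Sum>b\<in>Basis. coord v b *s b)"
  using sum_representation_eq[OF independent_Basis _ finite_Basis] by (simp add: span_Basis)

lemma linear_coord_expand:
  assumes "Vector_Spaces.linear scale s' f"
  shows "f v = (\<Sum>b\<in>Basis. s' (coord v b) (f b))"
proof -
  interpret f: Vector_Spaces.linear scale s' f by fact
  show ?thesis
    by (subst coord_expand[of v]) (simp only: f.sum f.scale)
qed

lemma tensor2_universal:
  fixes m n :: nat
  assumes \<phi>: "bilinear_map scale s' \<phi>"
    and eq: "(\<Sum>i<m. tensor2 (x i) (y i)) = (\<Sum>i<n. tensor2 (u i) (v i))"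
  shows "(\<Sum>i<m. \<phi> (x i) (y i)) = (\<Sum>i<n. \<phi> (u i) (v i))"
proof -
  have 1: "Vector_Spaces.linear scale s' (\<lambda>y. \<phi> x y)"
    and 2: "Vector_Spaces.linear scale s' (\<lambda>x. \<phi> x y)" for x y
    using \<phi> by (auto simp: bilinear_map_def)
  interpret s': vector_space s' using 1 by (simp add: vs_linear_iff)
  define c where "c x y b d = coord x b * coord y d" for x y b d
  have *: "\<phi> x y = (\<Sum>b\<in>Basis. \<Sum>d\<in>Basis. s' (c x y b d) (\<phi> b d))" for x y
    unfolding linear_coord_expand[OF 2, of x y]
    by (subst linear_coord_expand[OF 1]) (simp add: s'.scale_sum_right c_def)
  have **: "(\<Sum>i<k. \<phi> (x i) (y i)) = (\<Sum>b\<in>Basis. \<Sum>d\<in>Basis.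
      s' ((\<Sum>i<k. tensor2 (x i) (y i)) (\<lambda>v. coord v b) (\<lambda>v. coord v d)) (\<phi> b d))" for k :: nat and x y
  proof -
    have "(\<Sum>i<k. \<phi> (x i) (y i)) =
        (\<Sum>i<k. \<Sum>b\<in>Basis. \<Sum>d\<in>Basis. s' (c (x i) (y i) b d) (\<phi> b d))"
      by (subst *) (rule refl)
    also have "\<dots> = (\<Sum>b\<in>Basis. \<Sum>d\<in>Basis. \<Sum>i<k. s' (c (x i) (y i) b d) (\<phi> b d))"
      by (subst sum.swap, rule sum.cong[OF refl], subst sum.swap, rule refl)
    finally show ?thesis
      by (simp add: sum_fun tensor2_def coord_dual s'.scale_sum_left c_def)
  qed
  show ?thesis by (simp only: ** eq)
qed

lemma tensor3_universal:
  fixes m n :: nat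
  assumes \<phi>: "trilinear_map scale s' \<phi>"
    and eq: "(\<Sum>i<m. tensor3 (x i) (y i) (z i)) = (\<Sum>i<n. tensor3 (u i) (v i) (w i))"
  shows "(\<Sum>i<m. \<phi> (x i) (y i) (z i)) = (\<Sum>i<n. \<phi> (u i) (v i) (w i))"
proof -
  have 1: "Vector_Spaces.linear scale s' (\<lambda>z. \<phi> x y z)"
    and 2: "Vector_Spaces.linear scale s' (\<lambda>y. \<phi> x y z)"
    and 3: "Vector_Spaces.linear scale s' (\<lambda>x. \<phi> x y z)" for x y z
    using \<phi> by (auto simp: trilinear_map_def)
  interpret s': vector_space s' using 1 by (simp add: vs_linear_iff)
  define c where "c x y z b d e = coord x b * coord y d * coord z e" for x y z b d e
  have *: "\<phi> x y z = (\<Sum>b\<in>Basis. \<Sum>d\<in>Basis. \<Sum>e\<in>Basis. s' (c x y z b d e) (\<phi> b d e))" for x y z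
    unfolding linear_coord_expand[OF 3, of x y z]
    apply (subst linear_coord_expand[OF 2])
    apply (subst linear_coord_expand[OF 1])
    apply (simp add: s'.scale_sum_right c_def mult.assoc)
    done
  have **: "(\<Sum>i<k. \<phi> (x i) (y i) (z i)) = (\<Sum>b\<in>Basis. \<Sum>d\<in>Basis. \<Sum>e\<in>Basis.
      s' ((\<Sum>i<k. tensor3 (x i) (y i) (z i)) (\<lambda>v. coord v b) (\<lambda>v. coord v d) (\<lambda>v. coord v e))
        (\<phi> b d e))" for k :: nat and x y z
  proof -
    have "(\<Sum>i<k. \<phi> (x i) (y i) (z i)) =
        (\<Sum>i<k. \<Sum>b\<in>Basis. \<Sum>d\<in>Basis. \<Sum>e\<in>Basis. s' (c (x i) (y i) (z i) b d e) (\<phi> b d e))"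
      by (subst *) (rule refl)
    also have "\<dots> = (\<Sum>b\<in>Basis. \<Sum>d\<in>Basis. \<Sum>e\<in>Basis. \<Sum>i<k.
        s' (c (x i) (y i) (z i) b d e) (\<phi> b d e))"
      by (subst sum.swap, rule sum.cong[OF refl], subst sum.swap, rule sum.cong[OF refl],
          subst sum.swap, rule refl)
    finally show ?thesis
      by (simp add: sum_fun tensor3_def coord_dual s'.scale_sum_left c_def)
  qed
  show ?thesis by (simp only: ** eq)
qed

end

section \<open>DPP algebras\<close>

locale perm_algebra = vector_space scale
  for scale :: "'k::field \<Rightarrow> 'v::ab_group_add \<Rightarrow> 'v"  (infixr \<open>*s\<close> 75) +
  fixes perm :: "'v \<Rightarrow> 'v \<Rightarrow> 'v"  (infixl \<open>\<odot>\<close> 70)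
  assumes perm_bilinear: "bilinear_map scale scale (\<odot>)"
    and perm_assoc: "a\<^sub>1 \<odot> (a\<^sub>2 \<odot> a\<^sub>3) = (a\<^sub>1 \<odot> a\<^sub>2) \<odot> a\<^sub>3"
    and perm_left_comm: "(a\<^sub>1 \<odot> a\<^sub>2) \<odot> a\<^sub>3 = (a\<^sub>2 \<odot> a\<^sub>1) \<odot> a\<^sub>3"

locale leibniz_algebra = vector_space scale
  for scale :: "'k::field \<Rightarrow> 'v::ab_group_add \<Rightarrow> 'v"  (infixr \<open>*s\<close> 75) +
  fixes leib :: "'v \<Rightarrow> 'v \<Rightarrow> 'v"  (infixl \<open>\<star>\<close> 70)
  assumes leib_bilinear: "bilinear_map scale scale (\<star>)"
    and leibniz: "a\<^sub>1 \<star> (a\<^sub>2 \<star> a\<^sub>3) = (a\<^sub>1 \<star> a\<^sub>2) \<star> a\<^sub>3 + a\<^sub>2 \<star> (a\<^sub>1 \<star> a\<^sub>3)"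

locale dpp_algebra = perm_algebra scale perm + leibniz_algebra scale leib
  for scale :: "'k::field \<Rightarrow> 'v::ab_group_add \<Rightarrow> 'v"  (infixr \<open>*s\<close> 75)
    and perm :: "'v \<Rightarrow> 'v \<Rightarrow> 'v"  (infixl \<open>\<odot>\<close> 70)
    and leib :: "'v \<Rightarrow> 'v \<Rightarrow> 'v"  (infixl \<open>\<star>\<close> 70) +
  assumes perm_leib: "(a\<^sub>1 \<odot> a\<^sub>2) \<star> a\<^sub>3 = a\<^sub>1 \<odot> (a\<^sub>2 \<star> a\<^sub>3) + a\<^sub>2 \<odot> (a\<^sub>1 \<star> a\<^sub>3)"
    and leib_perm: "(a\<^sub>1 \<star> a\<^sub>2) \<odot> a\<^sub>3 = a\<^sub>1 \<star> (a\<^sub>2 \<odot> a\<^sub>3) - a\<^sub>2 \<odot> (a\<^sub>1 \<star> a\<^sub>3)"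
    and leib_perm_skew: "(a\<^sub>1 \<star> a\<^sub>2) \<odot> a\<^sub>3 = - ((a\<^sub>2 \<star> a\<^sub>1) \<odot> a\<^sub>3)"
begin

abbreviation L :: "'v \<Rightarrow> 'v \<Rightarrow> 'v" where "L a \<equiv> \<lambda>b. a \<odot> b"
abbreviation R :: "'v \<Rightarrow> 'v \<Rightarrow> 'v" where "R a \<equiv> \<lambda>b. b \<odot> a"
abbreviation L' :: "'v \<Rightarrow> 'v \<Rightarrow> 'v" where "L' a \<equiv> \<lambda>b. a \<star> b"
abbreviation R' :: "'v \<Rightarrow> 'v \<Rightarrow> 'v" where "R' a \<equiv> \<lambda>b. b \<star> a"

definition nu_r :: "('k, 'v) tensor2 \<Rightarrow> 'v \<Rightarrow> ('k, 'v) tensor2"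
  where "nu_r r a = (id \<otimes>\<^sub>m R a + (R a - L a) \<otimes>\<^sub>m id) r"

definition theta_r :: "('k, 'v) tensor2 \<Rightarrow> 'v \<Rightarrow> ('k, 'v) tensor2"
  where "theta_r r a = ((L' a + R' a) \<otimes>\<^sub>m id - id \<otimes>\<^sub>m R' a) r"

definition P_sum :: "nat \<Rightarrow> (nat \<Rightarrow> 'v) \<Rightarrow> (nat \<Rightarrow> 'v) \<Rightarrow> ('k, 'v) tensor3"
  where "P_sum n x y = (\<Sum>i<n. \<Sum>j<n.
      tensor3 (x i) (y i \<odot> x j) (y j) - tensor3 (x i) (x j) (y i \<odot> y j)
    + tensor3 (x i \<odot> x j) (y i) (y j) - tensor3 (x i \<odot> x j) (y j) (y i))"

definition L_sum :: "nat \<Rightarrow> (nat \<Rightarrow> 'v) \<Rightarrow> (nat \<Rightarrow> 'v) \<Rightarrow> ('k, 'v) tensor3"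
  where "L_sum n x y = (\<Sum>i<n. \<Sum>j<n.
      tensor3 (x i \<star> x j) (y i) (y j) - tensor3 (x i) (y i \<star> x j) (y j)
    - tensor3 (x j) (x i \<star> y j) (y i) + tensor3 (x j) (x i) (y i \<star> y j))"

text \<open>
  The values of the sums do not depend on how \<open>r\<close> is written as \<open>\<Sum>i. x i \<otimes> y i\<close>, and every \<open>r\<close> in
  \<^term>\<open>tensor2_space\<close> can be so written.
\<close>

definition dpybe :: "('k, 'v) tensor2 \<Rightarrow> bool"
  where "dpybe r \<longleftrightarrow> r \<in> tensor2_space \<and>
    (\<forall>n x y. r = (\<Sum>i<n. tensor2 (x i) (y i)) \<longrightarrow> P_sum n x y = 0 \<and> L_sum n x y = 0)"

end

locale quadratic_rota_baxter_dpp_algebra = dpp_algebra scale perm leib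
  for scale :: "'k::field \<Rightarrow> 'v::ab_group_add \<Rightarrow> 'v"  (infixr \<open>*s\<close> 75)
    and perm :: "'v \<Rightarrow> 'v \<Rightarrow> 'v"  (infixl \<open>\<odot>\<close> 70)
    and leib :: "'v \<Rightarrow> 'v \<Rightarrow> 'v"  (infixl \<open>\<star>\<close> 70) +
  fixes \<omega> :: "'v \<Rightarrow> 'v \<Rightarrow> 'k" and rb :: "'v \<Rightarrow> 'v"
  assumes form_bilinear: "bilinear_map scale (*) \<omega>"
    and form_nondegenerate: "(\<And>b. \<omega> a b = 0) \<Longrightarrow> a = 0" "(\<And>a. \<omega> a b = 0) \<Longrightarrow> b = 0"
    and form_skew: "\<omega> a b = - \<omega> b a"
    and form_perm: "\<omega> (a\<^sub>1 \<odot> a\<^sub>2) a\<^sub>3 = \<omega> a\<^sub>1 (a\<^sub>2 \<odot> a\<^sub>3 - a\<^sub>3 \<odot> a\<^sub>2)"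
    and form_leib: "\<omega> (a\<^sub>1 \<star> a\<^sub>2) a\<^sub>3 = \<omega> a\<^sub>1 (a\<^sub>2 \<star> a\<^sub>3 + a\<^sub>3 \<star> a\<^sub>2)"
    and rb_linear: "Vector_Spaces.linear scale scale rb"
    and rb_perm: "rb a\<^sub>1 \<odot> rb a\<^sub>2 = rb (rb a\<^sub>1 \<odot> a\<^sub>2 + a\<^sub>1 \<odot> rb a\<^sub>2)"
    and rb_leib: "rb a\<^sub>1 \<star> rb a\<^sub>2 = rb (rb a\<^sub>1 \<star> a\<^sub>2 + a\<^sub>1 \<star> rb a\<^sub>2)"
    and rb_form: "\<omega> a\<^sub>1 (rb a\<^sub>2) + \<omega> (rb a\<^sub>1) a\<^sub>2 = 0"

section \<open>DPP coalgebras and bialgebras\<close>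

locale dpp_coalgebra = vector_space scale
  for scale :: "'k::field \<Rightarrow> 'v::ab_group_add \<Rightarrow> 'v"  (infixr \<open>*s\<close> 75) +
  fixes \<nu> \<theta> :: "'v \<Rightarrow> ('k, 'v) tensor2"
  assumes nu_mem: "\<nu> a \<in> tensor2_space"
    and theta_mem: "\<theta> a \<in> tensor2_space"
    and nu_linear: "Vector_Spaces.linear scale tensor2_scale \<nu>"
    and theta_linear: "Vector_Spaces.linear scale tensor2_scale \<theta>"
    and nu_coassoc: "\<nu> \<otimes>id (\<nu> a) = id\<otimes> \<nu> (\<nu> a)"
    and nu_cocomm: "id\<otimes> \<nu> (\<nu> a) = \<tau>\<^sub>1\<^sub>2 (id\<otimes> \<nu> (\<nu> a))"
    and theta_coleibniz: "id\<otimes> \<theta> (\<theta> a) = \<theta> \<otimes>id (\<theta> a) + \<tau>\<^sub>1\<^sub>2 (id\<otimes> \<theta> (\<theta> a))"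
    and nu_theta: "id\<otimes> \<nu> (\<theta> a) = \<theta> \<otimes>id (\<nu> a) + \<tau>\<^sub>1\<^sub>2 (id\<otimes> \<theta> (\<nu> a))"
    and theta_nu: "\<nu> \<otimes>id (\<theta> a) = id\<otimes> \<theta> (\<nu> a) + \<tau>\<^sub>1\<^sub>2 (id\<otimes> \<theta> (\<nu> a))"
    and theta_nu_skew: "\<theta> \<otimes>id (\<nu> a) = - \<tau>\<^sub>1\<^sub>2 (\<theta> \<otimes>id (\<nu> a))"
begin

abbreviation nu_minus :: "'v \<Rightarrow> ('k, 'v) tensor2"  (\<open>\<nu>\<^sup>-\<close>) where "\<nu>\<^sup>- a \<equiv> \<nu> a - \<tau> (\<nu> a)"
abbreviation theta_plus :: "'v \<Rightarrow> ('k, 'v) tensor2"  (\<open>\<theta>\<^sup>+\<close>) where "\<theta>\<^sup>+ a \<equiv> \<theta> a + \<tau> (\<theta> a)"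

end

locale dpp_bialgebra = dpp_algebra scale perm leib + dpp_coalgebra scale \<nu> \<theta>
  for scale :: "'k::field \<Rightarrow> 'v::ab_group_add \<Rightarrow> 'v"  (infixr \<open>*s\<close> 75)
    and perm :: "'v \<Rightarrow> 'v \<Rightarrow> 'v"  (infixl \<open>\<odot>\<close> 70)
    and leib :: "'v \<Rightarrow> 'v \<Rightarrow> 'v"  (infixl \<open>\<star>\<close> 70)
    and \<nu> \<theta> :: "'v \<Rightarrow> ('k, 'v) tensor2" +
  assumes perm_bialgebra:
      "(R a\<^sub>1 \<otimes>\<^sub>m id) (\<nu> a\<^sub>2) = \<tau> ((R a\<^sub>2 \<otimes>\<^sub>m id) (\<nu> a\<^sub>1))"
      "\<nu> (a\<^sub>1 \<odot> a\<^sub>2) = ((L a\<^sub>1 - R a\<^sub>1) \<otimes>\<^sub>m id) (\<nu> a\<^sub>2) + (id \<otimes>\<^sub>m R a\<^sub>2) (\<nu> a\<^sub>1)"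
      "\<nu> (a\<^sub>1 \<odot> a\<^sub>2) = (id \<otimes>\<^sub>m L a\<^sub>1) (\<nu> a\<^sub>2) + ((L a\<^sub>2 - R a\<^sub>2) \<otimes>\<^sub>m id) (\<nu>\<^sup>- a\<^sub>1)"
    and leibniz_bialgebra:
      "\<tau> ((R' a\<^sub>2 \<otimes>\<^sub>m id) (\<theta> a\<^sub>1)) = (R' a\<^sub>1 \<otimes>\<^sub>m id) (\<theta> a\<^sub>2)"
      "\<theta> (a\<^sub>1 \<star> a\<^sub>2) = (id \<otimes>\<^sub>m R' a\<^sub>2 - (L' a\<^sub>2 + R' a\<^sub>2) \<otimes>\<^sub>m id) (\<theta>\<^sup>+ a\<^sub>1)
        + (id \<otimes>\<^sub>m L' a\<^sub>1 + L' a\<^sub>1 \<otimes>\<^sub>m id) (\<theta> a\<^sub>2)"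
    and dpp_bialgebra:
      "\<nu> (a\<^sub>1 \<star> a\<^sub>2) = (id \<otimes>\<^sub>m L' a\<^sub>1 + L' a\<^sub>1 \<otimes>\<^sub>m id) (\<nu> a\<^sub>2)
        + ((L a\<^sub>2 - R a\<^sub>2) \<otimes>\<^sub>m id - id \<otimes>\<^sub>m R a\<^sub>2) (\<theta>\<^sup>+ a\<^sub>1)"
      "\<theta> (a\<^sub>1 \<odot> a\<^sub>2) = (id \<otimes>\<^sub>m L a\<^sub>1) (\<theta> a\<^sub>2) + (id \<otimes>\<^sub>m R a\<^sub>2) (\<theta> a\<^sub>1)
        - ((L' a\<^sub>1 + R' a\<^sub>1) \<otimes>\<^sub>m id) (\<nu> a\<^sub>2) - ((L' a\<^sub>2 + R' a\<^sub>2) \<otimes>\<^sub>m id) (\<nu>\<^sup>- a\<^sub>1)"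
      "(id \<otimes>\<^sub>m R' a\<^sub>1) (\<tau> (\<nu> a\<^sub>2)) = - (R a\<^sub>2 \<otimes>\<^sub>m id) (\<theta> a\<^sub>1)"
      "\<nu> (a\<^sub>1 \<star> a\<^sub>2) = (id \<otimes>\<^sub>m L a\<^sub>1 - L a\<^sub>1 \<otimes>\<^sub>m id) (\<theta> a\<^sub>2)
        + (id \<otimes>\<^sub>m R' a\<^sub>2 - (L' a\<^sub>2 + R' a\<^sub>2) \<otimes>\<^sub>m id) (\<nu>\<^sup>- a\<^sub>1)"
      "\<theta>\<^sup>+ (a\<^sub>1 \<odot> a\<^sub>2) = (id \<otimes>\<^sub>m L a\<^sub>1) (\<theta>\<^sup>+ a\<^sub>2) + (id \<otimes>\<^sub>m L a\<^sub>2) (\<theta>\<^sup>+ a\<^sub>1)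
        - (L' a\<^sub>1 \<otimes>\<^sub>m id) (\<nu>\<^sup>- a\<^sub>2) - (L' a\<^sub>2 \<otimes>\<^sub>m id) (\<nu>\<^sup>- a\<^sub>1)"
      "\<theta> (a\<^sub>1 \<odot> a\<^sub>2) = (L a\<^sub>1 \<otimes>\<^sub>m id) (\<theta> a\<^sub>2) - (id \<otimes>\<^sub>m R' a\<^sub>2) (\<nu>\<^sup>- a\<^sub>1)
        + (id \<otimes>\<^sub>m L' a\<^sub>1) (\<nu> a\<^sub>2) + ((L a\<^sub>2 - R a\<^sub>2) \<otimes>\<^sub>m id) (\<theta>\<^sup>+ a\<^sub>1)"
      "\<nu> (a\<^sub>1 \<star> a\<^sub>2 + a\<^sub>2 \<star> a\<^sub>1) = (id \<otimes>\<^sub>m (L' a\<^sub>1 + R' a\<^sub>1)) (\<nu> a\<^sub>2)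
        + ((L' a\<^sub>1 + R' a\<^sub>1) \<otimes>\<^sub>m id) (\<tau> (\<nu> a\<^sub>2))
        + (id \<otimes>\<^sub>m (L a\<^sub>2 - R a\<^sub>2)) (\<theta> a\<^sub>1) + ((L a\<^sub>2 - R a\<^sub>2) \<otimes>\<^sub>m id) (\<tau> (\<theta> a\<^sub>1))"

locale triangular_dpp_bialgebra = dpp_bialgebra scale perm leib \<nu> \<theta>
  for scale :: "'k::field \<Rightarrow> 'v::ab_group_add \<Rightarrow> 'v"  (infixr \<open>*s\<close> 75)
    and perm :: "'v \<Rightarrow> 'v \<Rightarrow> 'v"  (infixl \<open>\<odot>\<close> 70)
    and leib :: "'v \<Rightarrow> 'v \<Rightarrow> 'v"  (infixl \<open>\<star>\<close> 70)
    and \<nu> \<theta> :: "'v \<Rightarrow> ('k, 'v) tensor2" +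
  fixes r :: "('k, 'v) tensor2"
  assumes r_mem: "r \<in> tensor2_space"
    and r_symmetric: "\<tau> r = r"
    and r_dpybe: "dpybe r"
    and nu_eq: "\<nu> = nu_r r"
    and theta_eq: "\<theta> = theta_r r"

section \<open>The tensor of a form and an operator\<close>

context vector_space
begin

text \<open>
  A form \<open>\<omega>\<close> with values in the scalars is itself the map \<open>a \<mapsto> \<omega>(a, -)\<close>, which is \<open>J\<^sup>-\<^sup>1\<close>; for a
  nondegenerate form on a finite-dimensional space it is a bijection onto \<^term>\<open>dual\<close>.
\<close>

definition form_iso :: "('b \<Rightarrow> 'b \<Rightarrow> 'a) \<Rightarrow> ('b \<Rightarrow> 'a) \<Rightarrow> 'b"
  where "form_iso \<omega> = the_inv \<omega>"

definition form_tensor :: "('b \<Rightarrow> 'b \<Rightarrow> 'a) \<Rightarrow> ('b \<Rightarrow> 'b) \<Rightarrow> ('a, 'b) tensor2"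
  where "form_tensor \<omega> f =
    (\<lambda>\<xi>\<^sub>1 \<xi>\<^sub>2. if \<xi>\<^sub>1 \<in> dual \<and> \<xi>\<^sub>2 \<in> dual then \<xi>\<^sub>2 (f (form_iso \<omega> \<xi>\<^sub>1)) else 0)"

end

lemma (in finite_dimensional_vector_space) form_iso:
  assumes \<omega>: "bilinear_map scale (*) \<omega>" and nd: "\<And>a. (\<And>b. \<omega> a b = 0) \<Longrightarrow> a = 0"
  shows "bij_betw \<omega> UNIV dual"
    and "\<xi> \<in> dual \<Longrightarrow> \<omega> (form_iso \<omega> \<xi>) = \<xi>"
    and "form_iso \<omega> (\<omega> a) = a"
proof -
  have 1: "Vector_Spaces.linear scale (*) (\<lambda>y. \<omega> x y)"
    and 2: "Vector_Spaces.linear scale (*) (\<lambda>x. \<omega> x y)" for x y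
    using \<omega> by (auto simp: bilinear_map_def)
  have add: "\<omega> (x + x') y = \<omega> x y + \<omega> x' y" and sc: "\<omega> (c *s x) y = c * \<omega> x y" for x x' y c
    using 2[of y] by (auto simp: vs_linear_iff)
  have ext: "\<xi> = \<eta>" if "\<xi> \<in> dual" "\<eta> \<in> dual" "\<And>b. b \<in> Basis \<Longrightarrow> \<xi> b = \<eta> b" for \<xi> \<eta>
  proof
    fix v
    show "\<xi> v = \<eta> v"
      using linear_coord_expand[of "(*)" \<xi> v] linear_coord_expand[of "(*)" \<eta> v] that
      by (simp add: dual_def)
  qed
  have mem: "\<omega> a \<in> dual" for a
    using 1[of a] by (simp add: dual_def)
  define T where "T a = (\<Sum>b\<in>Basis. \<omega> a b *s b)" for a
  have coord_sum: "coord (\<Sum>b\<in>Basis. f b *s b) d = f d" if "d \<in> Basis" for f d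
  proof -
    have "(\<Sum>b\<in>Basis. (coord (\<Sum>b\<in>Basis. f b *s b) b - f b) *s b) = 0"
      using coord_expand[of "\<Sum>b\<in>Basis. f b *s b"]
      by (simp add: scale_left_diff_distrib sum_subtractf)
    then show ?thesis
      using independentD[OF independent_Basis finite_Basis order_refl] that by fastforce
  qed
  have T: "Vector_Spaces.linear scale scale T"
    by (simp add: vs_linear_iff vector_space_axioms T_def add sc scale_left_distrib sum.distrib
        scale_sum_right)
  have eq: "\<omega> a b = \<xi> b" if "T a = (\<Sum>b\<in>Basis. \<xi> b *s b)" "b \<in> Basis" for a b \<xi>
    using coord_sum[OF that(2), of "\<omega> a"] coord_sum[OF that(2), of \<xi>] that(1) by (simp add: T_def)
  have inj: "inj \<omega>"
  proof (rule injI)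
    fix a a' assume e: "\<omega> a = \<omega> a'"
    have "\<omega> (a + (- 1) *s a') b = 0" for b
      using e by (simp only: add sc) simp
    then show "a = a'" using nd[of "a + (- 1) *s a'"] by simp
  qed
  have "inj T"
  proof (rule injI)
    fix a a' assume "T a = T a'"
    then have "\<omega> a = \<omega> a'"
      using eq[of a "\<omega> a'"] by (intro ext mem) (simp add: T_def)
    then show "a = a'" using inj by (simp add: inj_eq)
  qed
  then have "surj T" by (rule linear_inj_imp_surj[OF T])
  have "\<xi> \<in> range \<omega>" if "\<xi> \<in> dual" for \<xi>
  proof -
    obtain a where "T a = (\<Sum>b\<in>Basis. \<xi> b *s b)" using \<open>surj T\<close> by (metis surjD)
    then have "\<omega> a = \<xi>" using eq by (intro ext mem that) blast
    then show ?thesis by blast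
  qed
  then have ran: "range \<omega> = dual" using mem by auto
  then show "bij_betw \<omega> UNIV dual" using inj by (simp add: bij_betw_def)
  show "\<omega> (form_iso \<omega> \<xi>) = \<xi>" if "\<xi> \<in> dual"
    using that ran f_the_inv_into_f[OF inj] by (simp add: form_iso_def)
  show "form_iso \<omega> (\<omega> a) = a"
    using the_inv_f_f[OF inj] by (simp add: form_iso_def)
qed

end

theory Submission
  imports Defs
begin

text \<open>
  Identify \<open>A\<^sup>*\<close> with \<open>A\<close> through \<open>\<omega>\<close>: every functional is \<open>\<omega> u\<close> for a unique \<open>u\<close>, and a tensor
  \<open>t\<close> becomes the operator \<open>T\<close> with \<open>t (\<omega> u) \<eta> = \<eta> (T u)\<close>.  The tensor \<open>r\<^sub>\<omega>\<close> becomes \<open>R\<close>, the flip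
  becomes \<open>T \<mapsto> - T\<^sup>*\<close> and \<open>f \<otimes> g\<close> becomes \<open>T \<mapsto> g T f\<^sup>*\<close>, where invariance of \<open>\<omega>\<close> expresses the
  adjoints of all multiplication operators by multiplication operators.  The compatibility
  conditions of a bialgebra thereby turn into identities in \<open>A\<close> that are linear in \<open>R\<close> and follow
  from the DPP axioms.  The coproducts are dual to the products \<open>R u \<circ> v + u \<circ> R v\<close> and
  \<open>R u \<ast> v + u \<ast> R v\<close>, which form a DPP algebra because \<open>R\<close> is a Rota-Baxter operator, and the
  DPYBE is the Rota-Baxter identity paired with \<open>\<omega>\<close>.
\<close>

section \<open>Rules for bilinear maps and the standing setting\<close>

lemma (in vector_space) bilinear_map_simps:
  assumes "bilinear_map scale s' f"
  shows "f (x + y) z = f x z + f y z" "f z (x + y) = f z x + f z y"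
    and "f (x - y) z = f x z - f y z" "f z (x - y) = f z x - f z y"
    and "f (- x) z = - f x z" "f z (- x) = - f z x"
    and "f 0 z = 0" "f z 0 = 0"
    and "f (c *s x) z = s' c (f x z)" "f z (c *s x) = s' c (f z x)"
    and "f (\<Sum>i\<in>I. g i) z = (\<Sum>i\<in>I. f (g i) z)" "f z (\<Sum>i\<in>I. g i) = (\<Sum>i\<in>I. f z (g i))"
proof -
  interpret l: Vector_Spaces.linear scale s' "\<lambda>x. f x z"
    using assms by (simp add: bilinear_map_def)
  interpret r: Vector_Spaces.linear scale s' "\<lambda>x. f z x"
    using assms by (simp add: bilinear_map_def)
  show "f (x + y) z = f x z + f y z" "f z (x + y) = f z x + f z y"
    "f (x - y) z = f x z - f y z" "f z (x - y) = f z x - f z y"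
    "f (- x) z = - f x z" "f z (- x) = - f z x"
    "f 0 z = 0" "f z 0 = 0"
    "f (c *s x) z = s' c (f x z)" "f z (c *s x) = s' c (f z x)"
    "f (\<Sum>i\<in>I. g i) z = (\<Sum>i\<in>I. f (g i) z)" "f z (\<Sum>i\<in>I. g i) = (\<Sum>i\<in>I. f z (g i))"
    by (fact l.add r.add l.diff r.diff l.neg r.neg l.zero r.zero l.scale r.scale l.sum r.sum)+
qed

text \<open>Finite dimension enters in two places: every functional is some
  \<open>\<omega> u\<close> (\<open>dual_form\<close>), and the tensor of a linear operator is a
  finite sum of pure tensors (\<open>represents_mem\<close>).\<close>

locale finite_dimensional_quadratic_rota_baxter_dpp_algebra =
  quadratic_rota_baxter_dpp_algebra scale perm leib \<omega> rb +
  finite_dimensional_vector_space scale Basis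
  for scale :: "'k::field \<Rightarrow> 'v::ab_group_add \<Rightarrow> 'v"  (infixr \<open>*s\<close> 75)
    and perm :: "'v \<Rightarrow> 'v \<Rightarrow> 'v"  (infixl \<open>\<odot>\<close> 70)
    and leib :: "'v \<Rightarrow> 'v \<Rightarrow> 'v"  (infixl \<open>\<star>\<close> 70)
    and \<omega> :: "'v \<Rightarrow> 'v \<Rightarrow> 'k" and rb :: "'v \<Rightarrow> 'v" and Basis :: "'v set"
begin

lemmas form_simps = bilinear_map_simps[OF form_bilinear]
  and perm_simps = bilinear_map_simps[OF perm_bilinear]
  and leib_simps = bilinear_map_simps[OF leib_bilinear]

lemma rb_simps:
  "rb (x + y) = rb x + rb y" "rb (x - y) = rb x - rb y" "rb (- x) = - rb x" "rb 0 = 0"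
  "rb (c *s x) = c *s rb x"
proof -
  interpret rb: Vector_Spaces.linear scale scale rb by (fact rb_linear)
  show "rb (x + y) = rb x + rb y" "rb (x - y) = rb x - rb y" "rb (- x) = - rb x" "rb 0 = 0"
    "rb (c *s x) = c *s rb x"
    by (fact rb.add rb.diff rb.neg rb.zero rb.scale)+
qed

lemma form_dual: "\<omega> u \<in> dual"
  using form_bilinear by (simp add: bilinear_map_def dual_def)

lemma dual_form: "\<xi> \<in> dual \<Longrightarrow> \<exists>u. \<xi> = \<omega> u"
  using form_iso(2)[OF form_bilinear form_nondegenerate(1)] by metis

lemma form_eqI: "(\<And>v. \<omega> v a = \<omega> v b) \<Longrightarrow> a = b"
  using form_nondegenerate(2)[of "a - b"] by (simp add: form_simps)

section \<open>Adjoints with respect to the form\<close>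

lemma form_R: "\<omega> u (x \<odot> a) = \<omega> (a \<odot> u - u \<odot> a) x"
  using form_perm[of x a u] form_skew by metis

text \<open>Invariance says that \<open>R a\<close> is the adjoint of \<open>L a - R a\<close>.
  Adding the adjoint of \<open>R a\<close> from \<open>form_R\<close> cancels the terms
  \<open>u \<odot> a\<close> and leaves \<open>L a\<close> self-adjoint. The same computation makes
  \<open>L' a\<close> skew-adjoint in \<open>form_L'\<close>.\<close>

lemma form_L: "\<omega> u (a \<odot> x) = \<omega> (a \<odot> u) x"
  using form_perm[of u a x] form_R[of u x a] by (simp add: form_simps)

lemma form_R': "\<omega> u (x \<star> a) = \<omega> (a \<star> u + u \<star> a) x"
  using form_leib[of x a u] form_skew by metis

lemma form_L': "\<omega> u (a \<star> x) = \<omega> (- (a \<star> u)) x"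
  using form_leib[of u a x] form_R'[of u x a] by (simp add: form_simps eq_neg_iff_add_eq_0 add.commute)

lemma form_rb: "\<omega> u (rb x) = \<omega> (- rb u) x"
  using rb_form[of u x] by (simp add: form_simps eq_neg_iff_add_eq_0)

text \<open>The signs from the skewness of \<open>\<omega>\<close> and of \<open>rb\<close> cancel.
  This symmetry is that of \<open>r\<^sub>\<omega>\<close>.\<close>

lemma form_rb_commute: "\<omega> u (rb v) = \<omega> v (rb u)"
  using form_rb[of u v] form_skew[of "rb u" v] by (simp add: form_simps)

lemmas form_adjoint = form_R form_L form_R' form_L' form_rb

section \<open>Tensors as operators\<close>

text \<open>\<open>T u\<close> is the contraction of \<open>t\<close> with \<open>\<omega> u\<close>
  in the first slot. The vanishing clause follows the convention that tensors are \<open>0\<close>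
  outside the dual space, and lets \<open>T\<close> determine \<open>t\<close>.\<close>

definition represents :: "('k, 'v) tensor2 \<Rightarrow> ('v \<Rightarrow> 'v) \<Rightarrow> bool"
  where "represents t T \<longleftrightarrow> (\<forall>\<xi> \<eta>. \<xi> \<notin> dual \<or> \<eta> \<notin> dual \<longrightarrow> t \<xi> \<eta> = 0) \<and>
    (\<forall>u. \<forall>\<eta>\<in>dual. t (\<omega> u) \<eta> = \<eta> (T u))"

lemma represents_form: "represents t T \<Longrightarrow> t (\<omega> u) (\<omega> v) = \<omega> v (T u)"
  by (simp add: represents_def form_dual)

text \<open>Every functional is some \<open>\<omega> u\<close>, so equal operators force equal
  values. This reduces equations of tensors to equations in the algebra.\<close>

lemma represents_eqI:
  assumes "represents s S" "represents t T" "\<And>u. S u = T u"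
  shows "s = t"
proof (intro ext)
  fix \<xi> \<eta> show "s \<xi> \<eta> = t \<xi> \<eta>"
    using assms dual_form[of \<xi>] by (cases "\<xi> \<in> dual \<and> \<eta> \<in> dual") (auto simp: represents_def)
qed

lemma dual_simps:
  assumes "\<xi> \<in> dual"
  shows "\<xi> (x - y) = \<xi> x - \<xi> y" "\<xi> (- x) = - \<xi> x"
proof -
  obtain u where "\<xi> = \<omega> u" using dual_form[OF assms] by blast
  then show "\<xi> (x - y) = \<xi> x - \<xi> y" "\<xi> (- x) = - \<xi> x" by (simp_all add: form_simps)
qed

lemma represents_add:
  "represents s S \<Longrightarrow> represents t T \<Longrightarrow> represents (s + t) (\<lambda>u. S u + T u)"
  by (auto simp: represents_def dual_add)

lemma represents_diff:
  "represents s S \<Longrightarrow> represents t T \<Longrightarrow> represents (s - t) (\<lambda>u. S u - T u)"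
  by (auto simp: represents_def dual_simps)

lemma represents_plus_apply:
  "represents (F t) S \<Longrightarrow> represents (G t) T \<Longrightarrow> represents ((F + G) t) (\<lambda>u. S u + T u)"
  using represents_add by simp

lemma represents_minus_apply:
  "represents (F t) S \<Longrightarrow> represents (G t) T \<Longrightarrow> represents ((F - G) t) (\<lambda>u. S u - T u)"
  using represents_diff by simp

lemma represents_uminus: "represents t T \<Longrightarrow> represents (- t) (\<lambda>u. - T u)"
  by (auto simp: represents_def dual_simps)

lemma represents_flip:
  assumes "represents t T" "\<And>u v. \<omega> u (T v) = \<omega> v (T' u)"
  shows "represents (\<tau> t) T'"
  unfolding represents_def
proof (intro conjI allI ballI impI)
  fix \<xi> \<eta> assume "\<xi> \<notin> dual \<or> \<eta> \<notin> dual"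
  then show "\<tau> t \<xi> \<eta> = 0" using assms(1) by (auto simp: represents_def flip_def)
next
  fix u \<eta> assume "\<eta> \<in> dual"
  then obtain v where "\<eta> = \<omega> v" using dual_form by blast
  then show "\<tau> t (\<omega> u) \<eta> = \<eta> (T' u)"
    using assms represents_form[of t T v u] by (simp add: flip_def)
qed

text \<open>Composing \<open>\<omega> u\<close> with \<open>f\<close> gives
  \<open>\<omega> (f' u)\<close>, so \<open>f\<close> is absorbed into the argument of
  \<open>T\<close>. Composing \<open>\<omega> v\<close> with \<open>g\<close> gives
  \<open>\<omega> (g' v)\<close>, and moving \<open>g'\<close> back across the form leaves
  \<open>g\<close> outside \<open>T\<close>.\<close>

lemma represents_tensor_map:
  assumes t: "represents t T" and f: "\<And>u x. \<omega> u (f x) = \<omega> (f' u) x"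
    and g: "\<And>v y. \<omega> v (g y) = \<omega> (g' v) y"
  shows "represents ((f \<otimes>\<^sub>m g) t) (\<lambda>u. g (T (f' u)))"
proof -
  have "(f \<otimes>\<^sub>m g) t (\<omega> u) \<eta> = \<eta> (g (T (f' u)))" if "\<eta> \<in> dual" for u \<eta>
  proof -
    obtain v where v: "\<eta> = \<omega> v" using dual_form \<open>\<eta> \<in> dual\<close> by blast
    then show ?thesis
      using represents_form[OF t, of "f' u" "g' v"] f[of u] g[of v]
      by (simp add: tensor_map_def form_dual)
  qed
  then show ?thesis by (auto simp: represents_def tensor_map_def)
qed

lemma represents_tensor_map_simps:
  assumes "represents t T"
  shows "represents ((R a \<otimes>\<^sub>m id) t) (\<lambda>u. T (a \<odot> u - u \<odot> a))"
    and "represents ((L a \<otimes>\<^sub>m id) t) (\<lambda>u. T (a \<odot> u))"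
    and "represents (((L a - R a) \<otimes>\<^sub>m id) t) (\<lambda>u. T (u \<odot> a))"
    and "represents (((R a - L a) \<otimes>\<^sub>m id) t) (\<lambda>u. T (- (u \<odot> a)))"
    and "represents ((R' a \<otimes>\<^sub>m id) t) (\<lambda>u. T (a \<star> u + u \<star> a))"
    and "represents ((L' a \<otimes>\<^sub>m id) t) (\<lambda>u. T (- (a \<star> u)))"
    and "represents (((L' a + R' a) \<otimes>\<^sub>m id) t) (\<lambda>u. T (u \<star> a))"
    and "represents ((id \<otimes>\<^sub>m R a) t) (\<lambda>u. T u \<odot> a)"
    and "represents ((id \<otimes>\<^sub>m L a) t) (\<lambda>u. a \<odot> T u)"
    and "represents ((id \<otimes>\<^sub>m (L a - R a)) t) (\<lambda>u. a \<odot> T u - T u \<odot> a)"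
    and "represents ((id \<otimes>\<^sub>m R' a) t) (\<lambda>u. T u \<star> a)"
    and "represents ((id \<otimes>\<^sub>m L' a) t) (\<lambda>u. a \<star> T u)"
    and "represents ((id \<otimes>\<^sub>m (L' a + R' a)) t) (\<lambda>u. a \<star> T u + T u \<star> a)"
proof -
  have left: "represents ((f \<otimes>\<^sub>m id) t) (\<lambda>u. T (f' u))"
    if "\<And>v y. \<omega> v (f y) = \<omega> (f' v) y" for f f'
    using represents_tensor_map[OF assms, of f f' id id] that by simp
  have right: "represents ((id \<otimes>\<^sub>m g) t) (\<lambda>u. g (T u))"
    if "\<And>v y. \<omega> v (g y) = \<omega> (g' v) y" for g g'
    using represents_tensor_map[OF assms, of id id g g'] that by simp
  show "represents ((R a \<otimes>\<^sub>m id) t) (\<lambda>u. T (a \<odot> u - u \<odot> a))"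
    and "represents ((L a \<otimes>\<^sub>m id) t) (\<lambda>u. T (a \<odot> u))"
    and "represents (((L a - R a) \<otimes>\<^sub>m id) t) (\<lambda>u. T (u \<odot> a))"
    and "represents (((R a - L a) \<otimes>\<^sub>m id) t) (\<lambda>u. T (- (u \<odot> a)))"
    and "represents ((R' a \<otimes>\<^sub>m id) t) (\<lambda>u. T (a \<star> u + u \<star> a))"
    and "represents ((L' a \<otimes>\<^sub>m id) t) (\<lambda>u. T (- (a \<star> u)))"
    and "represents (((L' a + R' a) \<otimes>\<^sub>m id) t) (\<lambda>u. T (u \<star> a))"
    by (rule left; simp add: form_simps form_R[of _ _ a] form_L[of _ a] form_R'[of _ _ a]
        form_L'[of _ a])+
  show "represents ((id \<otimes>\<^sub>m R a) t) (\<lambda>u. T u \<odot> a)"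
    by (rule right[where g = "R a"]) (rule form_R)
  show "represents ((id \<otimes>\<^sub>m L a) t) (\<lambda>u. a \<odot> T u)"
    by (rule right[where g = "L a"]) (rule form_L)
  show "represents ((id \<otimes>\<^sub>m R' a) t) (\<lambda>u. T u \<star> a)"
    by (rule right[where g = "R' a"]) (rule form_R')
  show "represents ((id \<otimes>\<^sub>m L' a) t) (\<lambda>u. a \<star> T u)"
    by (rule right[where g = "L' a"]) (rule form_L')
  show "represents ((id \<otimes>\<^sub>m (L a - R a)) t) (\<lambda>u. a \<odot> T u - T u \<odot> a)"
    using right[where g = "L a - R a" and g' = "R a"]
    by (simp add: form_R[of _ _ a] form_L[of _ a] form_simps)
  show "represents ((id \<otimes>\<^sub>m (L' a + R' a)) t) (\<lambda>u. a \<star> T u + T u \<star> a)"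
    using right[where g = "L' a + R' a" and g' = "R' a"]
    by (simp add: form_R'[of _ _ a] form_L'[of _ a] form_simps)
qed

text \<open>Since \<open>T u\<close> is the sum of \<open>coord u b *s T b\<close> over the basis,
  \<open>t\<close> is the sum of the tensors of \<open>x b\<close> and \<open>T b\<close>, where
  \<open>x b\<close> is the vector with \<open>\<omega> u (x b) = coord u b\<close>.\<close>

lemma represents_mem:
  assumes t: "represents t T" and T: "Vector_Spaces.linear scale scale T"
  shows "t \<in> tensor2_space"
proof -
  \<comment> \<open>The coordinate functional is some \<open>\<omega> c\<close>; skew-symmetry moves
    \<open>c\<close> to the second slot, which is why \<open>- c b\<close> appears in the pure
    tensors.\<close>
  have "\<exists>c. \<forall>v. coord v b = - \<omega> v c" for b
    using dual_form[OF coord_dual[of b]] form_skew by metis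
  then obtain c where c: "coord v b = - \<omega> v (c b)" for b v by metis
  obtain e n where e: "bij_betw e {..<n::nat} Basis"
    using ex_bij_betw_nat_finite[OF finite_Basis] by (auto simp: lessThan_atLeast0)
  have "represents (\<Sum>i<n. tensor2 (- c (e i)) (T (e i))) T"
    unfolding represents_def
  proof (intro conjI allI ballI impI)
    fix u \<eta> assume \<eta>: "\<eta> \<in> dual"
    then obtain v where v: "\<eta> = \<omega> v" using dual_form by blast
    have "T u = (\<Sum>b\<in>Basis. coord u b *s T b)" by (rule linear_coord_expand[OF T])
    also have "\<dots> = (\<Sum>i<n. coord u (e i) *s T (e i))"
      by (rule sum.reindex_bij_betw[OF e, symmetric])
    finally show "(\<Sum>i<n. tensor2 (- c (e i)) (T (e i))) (\<omega> u) \<eta> = \<eta> (T u)"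
      using \<eta> by (simp add: sum_fun tensor2_def form_dual v form_simps c)
  qed (auto simp: sum_fun tensor2_def)
  then have "t = (\<Sum>i<n. tensor2 (- c (e i)) (T (e i)))"
    using t by (intro represents_eqI[of t T]) auto
  then show ?thesis
    unfolding tensor2_space_def
    by (intro CollectI exI[of _ n] exI[of _ "\<lambda>i. - c (e i)"] exI[of _ "\<lambda>i. T (e i)"]) simp
qed

section \<open>The operators of the tensor and of its coproducts\<close>

abbreviation r\<^sub>\<omega> where "r\<^sub>\<omega> \<equiv> form_tensor \<omega> rb"
abbreviation \<nu> where "\<nu> \<equiv> nu_r r\<^sub>\<omega>"
abbreviation \<theta> where "\<theta> \<equiv> theta_r r\<^sub>\<omega>"

lemma represents_r: "represents r\<^sub>\<omega> rb"
  by (simp add: represents_def form_tensor_def form_dual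
      form_iso(3)[OF form_bilinear form_nondegenerate(1)])

lemma r_symmetric: "\<tau> r\<^sub>\<omega> = r\<^sub>\<omega>"
  by (rule represents_eqI[OF represents_flip[OF represents_r form_rb_commute] represents_r refl])

lemma represents_nu: "represents (\<nu> a) (\<lambda>u. rb u \<odot> a - rb (u \<odot> a))"
  using represents_add[OF represents_tensor_map_simps(8)[OF represents_r, of a]
      represents_tensor_map_simps(4)[OF represents_r, of a]]
  by (simp add: nu_r_def rb_simps)

lemma represents_theta: "represents (\<theta> a) (\<lambda>u. rb (u \<star> a) - rb u \<star> a)"
  using represents_diff[OF represents_tensor_map_simps(7)[OF represents_r, of a]
      represents_tensor_map_simps(11)[OF represents_r, of a]]
  by (simp add: theta_r_def)

lemma represents_flip_nu:
  "represents (\<tau> (\<nu> a)) (\<lambda>u. rb (a \<odot> u - u \<odot> a) - a \<odot> rb u + rb u \<odot> a)"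
proof (rule represents_flip[OF represents_nu])
  fix u v
  \<comment> \<open>The adjoints strip \<open>v\<close> of all operators; skew-symmetry then
    exchanges the slots and changes the sign.\<close>
  have "\<omega> u (rb v \<odot> a - rb (v \<odot> a)) = \<omega> (- rb (a \<odot> u - u \<odot> a) + (a \<odot> rb u - rb u \<odot> a)) v"
    by (simp add: form_adjoint form_simps perm_simps leib_simps)
  then show "\<omega> u (rb v \<odot> a - rb (v \<odot> a)) =
      \<omega> v (rb (a \<odot> u - u \<odot> a) - a \<odot> rb u + rb u \<odot> a)"
    by (subst form_skew) (simp add: form_simps)
qed

lemma represents_flip_theta:
  "represents (\<tau> (\<theta> a)) (\<lambda>u. a \<star> rb u + rb u \<star> a - rb (a \<star> u + u \<star> a))"
proof (rule represents_flip[OF represents_theta])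
  fix u v
  have "\<omega> u (rb (v \<star> a) - rb v \<star> a) = \<omega> (- (a \<star> rb u + rb u \<star> a) + rb (a \<star> u + u \<star> a)) v"
    by (simp add: form_adjoint form_simps perm_simps leib_simps)
  then show "\<omega> u (rb (v \<star> a) - rb v \<star> a) =
      \<omega> v (a \<star> rb u + rb u \<star> a - rb (a \<star> u + u \<star> a))"
    by (subst form_skew) (simp add: form_simps)
qed

text \<open>All terms with \<open>a\<close> as right factor cancel. What is left is the commutator
  of \<open>L a\<close> with \<open>rb\<close>, and in \<open>represents_theta_plus\<close> that of
  \<open>L' a\<close> with \<open>rb\<close>.\<close>

lemma represents_nu_minus: "represents (\<nu> a - \<tau> (\<nu> a)) (\<lambda>u. a \<odot> rb u - rb (a \<odot> u))"
  using represents_diff[OF represents_nu[of a] represents_flip_nu[of a]]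
  by (simp add: rb_simps algebra_simps)

lemma represents_theta_plus: "represents (\<theta> a + \<tau> (\<theta> a)) (\<lambda>u. a \<star> rb u - rb (a \<star> u))"
  using represents_add[OF represents_theta[of a] represents_flip_theta[of a]]
  by (simp add: rb_simps algebra_simps)

section \<open>The bialgebra conditions\<close>

lemma perm_left_commute: "a \<odot> (b \<odot> c) = b \<odot> (a \<odot> c)"
  by (simp add: perm_assoc perm_left_comm)

lemma leib_leib: "(a \<star> b) \<star> c = a \<star> (b \<star> c) - b \<star> (a \<star> c)"
  using leibniz[of a b c] by (simp add: algebra_simps)

text \<open>This is \<open>leib_perm_skew\<close> with both sides expanded by
  \<open>leib_perm\<close>, so that all products are nested to the right as in
  \<open>dpp_simps\<close>.\<close>

lemma leib_perm_swap: "a \<star> (b \<odot> c) + b \<star> (a \<odot> c) = a \<odot> (b \<star> c) + b \<odot> (a \<star> c)"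
  using leib_perm_skew[of a b c] by (simp add: leib_perm algebra_simps)

text \<open>As rewrite rules these nest every product to the right, so that the operator identities
  become linear identities between monomials.\<close>

lemmas dpp_simps = perm_assoc[symmetric] perm_left_commute perm_leib leib_perm leib_leib
lemmas linear_simps = perm_simps leib_simps rb_simps

text \<open>Resolution with these rules computes the operator of a tensor from its syntax. The rules
  for the skew and symmetric parts come first, so that they apply before sums and differences are
  split.\<close>

lemmas represents_intros =
  represents_nu_minus represents_theta_plus represents_flip_nu represents_flip_theta
  represents_nu represents_theta represents_tensor_map_simps represents_add represents_diff
  represents_plus_apply represents_minus_apply represents_uminus

text \<open>Moves the flip inward to the coproducts, where its operator is known.\<close>

lemma flip_tensor_map: "\<tau> ((f \<otimes>\<^sub>m g) t) = (g \<otimes>\<^sub>m f) (\<tau> t)"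
  by (auto simp: flip_def tensor_map_def fun_eq_iff)

lemma perm_bialgebra:
  "(R a \<otimes>\<^sub>m id) (\<nu> b) = \<tau> ((R b \<otimes>\<^sub>m id) (\<nu> a))"
  "\<nu> (a \<odot> b) = ((L a - R a) \<otimes>\<^sub>m id) (\<nu> b) + (id \<otimes>\<^sub>m R b) (\<nu> a)"
  "\<nu> (a \<odot> b) = (id \<otimes>\<^sub>m L a) (\<nu> b) + ((L b - R b) \<otimes>\<^sub>m id) (\<nu> a - \<tau> (\<nu> a))"
  unfolding flip_tensor_map
  by (rule represents_eqI, (rule represents_intros)+,
      simp add: dpp_simps linear_simps algebra_simps)+

lemma leibniz_bialgebra:
  "\<tau> ((R' b \<otimes>\<^sub>m id) (\<theta> a)) = (R' a \<otimes>\<^sub>m id) (\<theta> b)"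
  "\<theta> (a \<star> b) = (id \<otimes>\<^sub>m R' b - (L' b + R' b) \<otimes>\<^sub>m id) (\<theta> a + \<tau> (\<theta> a))
    + (id \<otimes>\<^sub>m L' a + L' a \<otimes>\<^sub>m id) (\<theta> b)"
  unfolding flip_tensor_map
  by (rule represents_eqI, (rule represents_intros)+,
      simp add: dpp_simps linear_simps algebra_simps)+

lemma dpp_bialgebra:
  "\<nu> (a \<star> b) = (id \<otimes>\<^sub>m L' a + L' a \<otimes>\<^sub>m id) (\<nu> b)
    + ((L b - R b) \<otimes>\<^sub>m id - id \<otimes>\<^sub>m R b) (\<theta> a + \<tau> (\<theta> a))"
  "\<theta> (a \<odot> b) = (id \<otimes>\<^sub>m L a) (\<theta> b) + (id \<otimes>\<^sub>m R b) (\<theta> a)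
    - ((L' a + R' a) \<otimes>\<^sub>m id) (\<nu> b) - ((L' b + R' b) \<otimes>\<^sub>m id) (\<nu> a - \<tau> (\<nu> a))"
  "(id \<otimes>\<^sub>m R' a) (\<tau> (\<nu> b)) = - (R b \<otimes>\<^sub>m id) (\<theta> a)"
  "\<nu> (a \<star> b) = (id \<otimes>\<^sub>m L a - L a \<otimes>\<^sub>m id) (\<theta> b)
    + (id \<otimes>\<^sub>m R' b - (L' b + R' b) \<otimes>\<^sub>m id) (\<nu> a - \<tau> (\<nu> a))"
  "\<theta> (a \<odot> b) + \<tau> (\<theta> (a \<odot> b)) =
    (id \<otimes>\<^sub>m L a) (\<theta> b + \<tau> (\<theta> b)) + (id \<otimes>\<^sub>m L b) (\<theta> a + \<tau> (\<theta> a))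
    - (L' a \<otimes>\<^sub>m id) (\<nu> b - \<tau> (\<nu> b)) - (L' b \<otimes>\<^sub>m id) (\<nu> a - \<tau> (\<nu> a))"
  by (rule represents_eqI, (rule represents_intros)+,
      simp add: dpp_simps linear_simps algebra_simps)+

text \<open>These two conditions rest on the skew axiom, through \<open>leib_perm_swap\<close>.
  Terms with \<open>rb\<close> applied to \<open>u\<close> and terms with \<open>rb\<close> applied
  last cancel separately, hence one instance at \<open>rb u\<close> and one at \<open>u\<close>
  under \<open>rb\<close>.\<close>

lemma dpp_bialgebra_skew:
  "\<theta> (a \<odot> b) = (L a \<otimes>\<^sub>m id) (\<theta> b) - (id \<otimes>\<^sub>m R' b) (\<nu> a - \<tau> (\<nu> a))
    + (id \<otimes>\<^sub>m L' a) (\<nu> b) + ((L b - R b) \<otimes>\<^sub>m id) (\<theta> a + \<tau> (\<theta> a))"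
  "\<nu> (a \<star> b + b \<star> a) = (id \<otimes>\<^sub>m (L' a + R' a)) (\<nu> b)
    + ((L' a + R' a) \<otimes>\<^sub>m id) (\<tau> (\<nu> b))
    + (id \<otimes>\<^sub>m (L b - R b)) (\<theta> a) + ((L b - R b) \<otimes>\<^sub>m id) (\<tau> (\<theta> a))"
  by (rule represents_eqI, (rule represents_intros)+,
      insert leib_perm_swap[of a "rb u" b for u] leib_perm_swap[of a u b for u, THEN arg_cong, of rb],
      simp add: dpp_simps linear_simps algebra_simps)+

section \<open>The coalgebra conditions\<close>

lemma nu_form: "\<nu> a (\<omega> u) (\<omega> v) = \<omega> (rb u \<odot> v + u \<odot> rb v) a"
  using form_L[of v "rb u" a] form_rb[of v "u \<odot> a"] form_L[of "rb v" u a]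
  by (simp add: represents_form[OF represents_nu] form_simps)

lemma theta_form: "\<theta> a (\<omega> u) (\<omega> v) = \<omega> (rb u \<star> v + u \<star> rb v) a"
  using form_L'[of v "rb u" a] form_rb[of v "u \<star> a"] form_L'[of "rb v" u a]
  by (simp add: represents_form[OF represents_theta] form_simps)

text \<open>The functional obtained by pairing \<open>\<delta>\<close> with
  \<open>\<omega> u\<close> and \<open>\<omega> v\<close> is again of the form
  \<open>\<omega> (d u v)\<close>, so iterated coproducts are dual to nested products.\<close>

lemma comap_form:
  assumes "\<And>a u v. \<delta> a (\<omega> u) (\<omega> v) = \<omega> (d u v) a" "\<And>a u v. \<epsilon> a (\<omega> u) (\<omega> v) = \<omega> (e u v) a"
  shows "\<delta> \<otimes>id (\<epsilon> a) (\<omega> u) (\<omega> v) (\<omega> w) = \<omega> (e (d u v) w) a"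
    and "id\<otimes> \<delta> (\<epsilon> a) (\<omega> u) (\<omega> v) (\<omega> w) = \<omega> (e u (d v w)) a"
  by (simp_all add: comap_id_def id_comap_def form_dual assms)

lemmas comap_nu_theta =
  comap_form[where \<delta> = \<nu> and \<epsilon> = \<nu>, OF nu_form nu_form]
  comap_form[where \<delta> = \<nu> and \<epsilon> = \<theta>, OF nu_form theta_form]
  comap_form[where \<delta> = \<theta> and \<epsilon> = \<nu>, OF theta_form nu_form]
  comap_form[where \<delta> = \<theta> and \<epsilon> = \<theta>, OF theta_form theta_form]

lemma tensor3_eqI:
  assumes "\<And>\<xi> \<eta> \<zeta>. \<not> (\<xi> \<in> dual \<and> \<eta> \<in> dual \<and> \<zeta> \<in> dual) \<Longrightarrow> s \<xi> \<eta> \<zeta> = t \<xi> \<eta> \<zeta>"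
    and "\<And>u v w. s (\<omega> u) (\<omega> v) (\<omega> w) = t (\<omega> u) (\<omega> v) (\<omega> w)"
  shows "s = t"
proof (intro ext)
  fix \<xi> \<eta> \<zeta> show "s \<xi> \<eta> \<zeta> = t \<xi> \<eta> \<zeta>"
    using assms dual_form[of \<xi>] dual_form[of \<eta>] dual_form[of \<zeta>]
    by (cases "\<xi> \<in> dual \<and> \<eta> \<in> dual \<and> \<zeta> \<in> dual") auto
qed

lemma linear_tensor2I:
  assumes "\<And>a. represents (\<delta> a) (T a)"
    and "\<And>a b u. T (a + b) u = T a u + T b u" "\<And>c a u. T (c *s a) u = c *s T a u"
  shows "Vector_Spaces.linear scale tensor2_scale \<delta>"
proof -
  have "\<delta> (a + b) = \<delta> a + \<delta> b" for a b
    by (rule represents_eqI[OF assms(1) represents_add[OF assms(1) assms(1)]]) (rule assms(2))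
  moreover have "represents (tensor2_scale c (\<delta> a)) (\<lambda>u. c *s T a u)" for c a
    using assms(1)[of a] by (auto simp: represents_def tensor2_scale_def dual_scale)
  then have "\<delta> (c *s a) = tensor2_scale c (\<delta> a)" for c a
    by (rule represents_eqI[OF assms(1)]) (rule assms(3))
  ultimately show ?thesis
    by (simp add: vs_linear_iff vector_space_axioms vector_space_tensor2_scale)
qed

lemma dpp_coalgebra: "dpp_coalgebra scale \<nu> \<theta>"
proof (intro dpp_coalgebra.intro dpp_coalgebra_axioms.intro vector_space_axioms)
  show "\<nu> a \<in> tensor2_space" for a
    by (rule represents_mem[OF represents_nu])
      (simp add: vs_linear_iff vector_space_axioms linear_simps algebra_simps)
  show "\<theta> a \<in> tensor2_space" for a
    by (rule represents_mem[OF represents_theta])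
      (simp add: vs_linear_iff vector_space_axioms linear_simps algebra_simps)
  show "Vector_Spaces.linear scale tensor2_scale \<nu>"
    by (rule linear_tensor2I[OF represents_nu]) (simp_all add: linear_simps algebra_simps)
  show "Vector_Spaces.linear scale tensor2_scale \<theta>"
    by (rule linear_tensor2I[OF represents_theta]) (simp_all add: linear_simps algebra_simps)
  have zero: "\<delta> \<otimes>id t \<xi> \<eta> \<zeta> = 0" "id\<otimes> \<delta> t \<xi> \<eta> \<zeta> = 0"
    "\<tau>\<^sub>1\<^sub>2 (\<delta> \<otimes>id t) \<xi> \<eta> \<zeta> = 0" "\<tau>\<^sub>1\<^sub>2 (id\<otimes> \<delta> t) \<xi> \<eta> \<zeta> = 0"
    if "\<not> (\<xi> \<in> dual \<and> \<eta> \<in> dual \<and> \<zeta> \<in> dual)" for \<delta> t \<xi> \<eta> \<zeta>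
    using that by (auto simp: comap_id_def id_comap_def flip12_def)
  \<comment> \<open>Read from right to left, the Rota-Baxter identities make \<open>rb\<close>
    multiplicative on the deformed products. They are applied before the sums under
    \<open>rb\<close> can be rearranged; each axiom then becomes a DPP axiom for the deformed
    products.\<close>
  note coalgebra_simps = flip12_def comap_nu_theta rb_perm[symmetric] rb_leib[symmetric]
  fix a
  show "\<nu> \<otimes>id (\<nu> a) = id\<otimes> \<nu> (\<nu> a)" "id\<otimes> \<nu> (\<nu> a) = \<tau>\<^sub>1\<^sub>2 (id\<otimes> \<nu> (\<nu> a))"
    "id\<otimes> \<theta> (\<theta> a) = \<theta> \<otimes>id (\<theta> a) + \<tau>\<^sub>1\<^sub>2 (id\<otimes> \<theta> (\<theta> a))"
    "id\<otimes> \<nu> (\<theta> a) = \<theta> \<otimes>id (\<nu> a) + \<tau>\<^sub>1\<^sub>2 (id\<otimes> \<theta> (\<nu> a))"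
    "\<nu> \<otimes>id (\<theta> a) = id\<otimes> \<theta> (\<nu> a) + \<tau>\<^sub>1\<^sub>2 (id\<otimes> \<theta> (\<nu> a))"
    by (rule tensor3_eqI, simp add: zero, simp only: plus_fun_apply coalgebra_simps,
        simp add: dpp_simps perm_simps leib_simps form_simps algebra_simps)+
  show "\<theta> \<otimes>id (\<nu> a) = - \<tau>\<^sub>1\<^sub>2 (\<theta> \<otimes>id (\<nu> a))"
  proof (rule tensor3_eqI)
    fix u v w
    show "\<theta> \<otimes>id (\<nu> a) (\<omega> u) (\<omega> v) (\<omega> w) = (- \<tau>\<^sub>1\<^sub>2 (\<theta> \<otimes>id (\<nu> a))) (\<omega> u) (\<omega> v) (\<omega> w)"
      \<comment> \<open>After expansion \<open>rb\<close> sits on two of the three arguments: one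
        instance of the skew axiom for each choice.\<close>
      using leib_perm_skew[of "rb u" "rb v" w] leib_perm_skew[of "rb u" v "rb w"]
        leib_perm_skew[of u "rb v" "rb w"]
      by (simp only: uminus_apply coalgebra_simps) (simp add: perm_simps form_simps)
  qed (simp add: zero)
qed

section \<open>The DPYBE\<close>

text \<open>In each term of the DPYBE two legs are paired with functionals and the other two are
  multiplied; by bilinearity the two copies of the tensor can be contracted independently.\<close>

lemma contraction:
  assumes "bilinear_map scale scale f"
  shows "(\<Sum>i<n::nat. \<Sum>j<n. c i * d j * \<omega> v (f (p i) (q j))) =
    \<omega> v (f (\<Sum>i<n. c i *s p i) (\<Sum>j<n. d j *s q j))"
  by (simp add: bilinear_map_simps[OF assms] form_simps sum_distrib_left mult.assoc)
    (subst sum.swap, simp add: mult.left_commute)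

text \<open>Contracting either leg of the tensor gives \<open>rb\<close>. Adjoints then bring all
  terms to the form \<open>\<omega> w\<close>, applied to the Rota-Baxter identity for
  \<open>u\<close>, \<open>v\<close> in the perm case and for \<open>v\<close>, \<open>u\<close> in
  the Leibniz case.\<close>

lemma dpybe: "dpybe r\<^sub>\<omega>"
  unfolding dpybe_def
proof (intro conjI allI impI)
  show "r\<^sub>\<omega> \<in> tensor2_space" by (rule represents_mem[OF represents_r rb_linear])
  fix n :: nat and x y assume r: "r\<^sub>\<omega> = (\<Sum>i<n. tensor2 (x i) (y i))"
  have r_form: "(\<Sum>i<n. \<omega> u (x i) * \<omega> v (y i)) = \<omega> v (rb u)" for u v
    using represents_form[OF represents_r, of u v]
    by (simp add: r sum_fun tensor2_def form_dual)
  have left: "(\<Sum>i<n. \<omega> u (x i) *s y i) = rb u" for u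
    by (rule form_eqI) (simp add: form_simps r_form)
  \<comment> \<open>Contraction of the second leg gives the same operator because the tensor is
    symmetric.\<close>
  have right: "(\<Sum>i<n. \<omega> v (y i) *s x i) = rb v" for v
  proof (rule form_eqI)
    fix u
    have "\<omega> u (\<Sum>i<n. \<omega> v (y i) *s x i) = \<omega> v (rb u)"
      using r_form[of u v] by (simp add: form_simps mult.commute)
    also have "\<dots> = \<omega> u (rb v)"
      by (rule form_rb_commute)
    finally show "\<omega> u (\<Sum>i<n. \<omega> v (y i) *s x i) = \<omega> u (rb v)" .
  qed
  show "P_sum n x y = 0"
  proof (rule tensor3_eqI)
    fix u v w
    have "P_sum n x y (\<omega> u) (\<omega> v) (\<omega> w) =
        (\<Sum>i<n. \<Sum>j<n. \<omega> u (x i) * \<omega> w (y j) * \<omega> v (y i \<odot> x j))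
      - (\<Sum>i<n. \<Sum>j<n. \<omega> u (x i) * \<omega> v (x j) * \<omega> w (y i \<odot> y j))
      + (\<Sum>i<n. \<Sum>j<n. \<omega> v (y i) * \<omega> w (y j) * \<omega> u (x i \<odot> x j))
      - (\<Sum>i<n. \<Sum>j<n. \<omega> w (y i) * \<omega> v (y j) * \<omega> u (x i \<odot> x j))"
      by (simp add: P_sum_def sum_fun tensor3_def form_dual sum.distrib sum_subtractf ac_simps)
    also have "\<dots> = \<omega> v (rb u \<odot> rb w) - \<omega> w (rb u \<odot> rb v)
        + (\<omega> u (rb v \<odot> rb w) - \<omega> u (rb w \<odot> rb v))"
      by (simp only: contraction[OF perm_bilinear] left right add_diff_eq)
    also have "\<omega> v (rb u \<odot> rb w) = \<omega> w (rb (rb u \<odot> v))"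
      by (simp only: form_L[of v] form_rb_commute[of _ w])
    \<comment> \<open>Invariance read backwards: the two terms together are
      \<open>\<omega> (u \<odot> rb v) (rb w)\<close>.\<close>
    also have "\<omega> u (rb v \<odot> rb w) - \<omega> u (rb w \<odot> rb v) = \<omega> w (rb (u \<odot> rb v))"
      using form_perm[of u "rb v" "rb w"] form_rb_commute[of "u \<odot> rb v" w] by (simp add: form_simps)
    finally show "P_sum n x y (\<omega> u) (\<omega> v) (\<omega> w) = 0 (\<omega> u) (\<omega> v) (\<omega> w)"
      by (simp add: rb_perm rb_simps form_simps)
  qed (auto simp: P_sum_def sum_fun tensor3_def)
  show "L_sum n x y = 0"
  proof (rule tensor3_eqI)
    fix u v w
    have "L_sum n x y (\<omega> u) (\<omega> v) (\<omega> w) =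
        (\<Sum>i<n. \<Sum>j<n. \<omega> v (y i) * \<omega> w (y j) * \<omega> u (x i \<star> x j))
      - (\<Sum>i<n. \<Sum>j<n. \<omega> u (x i) * \<omega> w (y j) * \<omega> v (y i \<star> x j))
      - (\<Sum>i<n. \<Sum>j<n. \<omega> w (y i) * \<omega> u (x j) * \<omega> v (x i \<star> y j))
      + (\<Sum>i<n. \<Sum>j<n. \<omega> v (x i) * \<omega> u (x j) * \<omega> w (y i \<star> y j))"
      by (simp add: L_sum_def sum_fun tensor3_def form_dual sum.distrib sum_subtractf ac_simps)
    also have "\<dots> = \<omega> u (rb v \<star> rb w) - (\<omega> v (rb u \<star> rb w) + \<omega> v (rb w \<star> rb u))
        + \<omega> w (rb v \<star> rb u)"
      by (simp only: contraction[OF leib_bilinear] left right diff_diff_eq)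
    also have "\<omega> u (rb v \<star> rb w) = - \<omega> w (rb (rb v \<star> u))"
      using form_rb_commute[of "rb v \<star> u" w] by (simp add: form_L'[of u] form_simps)
    also have "\<omega> v (rb u \<star> rb w) + \<omega> v (rb w \<star> rb u) = \<omega> w (rb (v \<star> rb u))"
      using form_leib[of v "rb u" "rb w"] form_rb_commute[of "v \<star> rb u" w] by (simp add: form_simps)
    finally show "L_sum n x y (\<omega> u) (\<omega> v) (\<omega> w) = 0 (\<omega> u) (\<omega> v) (\<omega> w)"
      by (simp add: rb_leib rb_simps form_simps)
  qed (auto simp: L_sum_def sum_fun tensor3_def)
qed

section \<open>Assembly of the triangular bialgebra\<close>

lemma triangular: "triangular_dpp_bialgebra scale perm leib \<nu> \<theta> r\<^sub>\<omega>"
proof -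
  interpret dpp_coalgebra scale \<nu> \<theta> by (fact dpp_coalgebra)
  show ?thesis
    by unfold_locales (fact perm_bialgebra leibniz_bialgebra dpp_bialgebra dpp_bialgebra_skew
        represents_mem[OF represents_r rb_linear] r_symmetric dpybe refl)+
qed

end

theorem proposition3p7:
  fixes scale :: "'k::field_char_0 \<Rightarrow> 'v::ab_group_add \<Rightarrow> 'v"
    and Basis :: "'v set"
    and perm leib :: "'v \<Rightarrow> 'v \<Rightarrow> 'v"
    and \<omega> :: "'v \<Rightarrow> 'v \<Rightarrow> 'k"
    and rb :: "'v \<Rightarrow> 'v"
    and r\<^sub>\<omega> :: "('k, 'v) tensor2"
  assumes "finite_dimensional_vector_space scale Basis"
    and "quadratic_rota_baxter_dpp_algebra scale perm leib \<omega> rb"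
  defines "r\<^sub>\<omega> \<equiv> vector_space.form_tensor scale \<omega> rb"
  shows "triangular_dpp_bialgebra scale perm leib
    (dpp_algebra.nu_r scale perm r\<^sub>\<omega>) (dpp_algebra.theta_r scale leib r\<^sub>\<omega>) r\<^sub>\<omega>"
proof -
  interpret finite_dimensional_quadratic_rota_baxter_dpp_algebra scale perm leib \<omega> rb Basis
    using assms(1,2) by (rule finite_dimensional_quadratic_rota_baxter_dpp_algebra.intro[rotated])
  show ?thesis
    unfolding r\<^sub>\<omega>_def by (rule triangular)
qed

end
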